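(* Fix an integer $k\ge2$, $m\ge1$ and $\varepsilon\in(0,1/k]$. For $\theta=(\pi,\mu,t)\in\mathcal S_{m,\varepsilon}$ with $\sigma_j=e^{t_j}$, define the responsibilities $$r_j(x;\theta):=\frac{\pi_j\varphi(x;\mu_j,\sigma_j)}{f_\theta(x)},\qquad j=1,\dots,k.$$ Then $r_j(x;\theta)\in[0,1]$ and $\sum_{j=1}^kr_j(x;\theta)=1$. Moreover, for each $j$ and all $x\in\mathbb{R}$, $$\partial_{\mu_j}\log f_\theta(x)=r_j(x;\theta)\frac{x-\mu_j}{\sigma_j^2},\quad \partial_{t_j}\log f_\theta(x)=r_j(x;\theta)\Big(-1+\frac{(x-\mu_j)^2}{\sigma_j^2}\Big),\quad \partial_{\pi_j}\log f_\theta(x)=\frac{r_j(x;\theta)}{\pi_j}.$$ Consequently, there exists $C_{m,\varepsilon,k}<\infty$ such that $$\sup_{\theta\in\mathcal S_{m,\varepsilon}}\|\nabla\log f_\theta(x)\|\le C_{m,\varepsilon,k}(1+x^2)\qquad\text{for all }x\in\mathbb{R},$$ where $\nabla$ is taken with respect to the ambient coordinates $(\pi,\mu,t)\in\mathbb{R}^{3k}$ and $\|\cdot\|$ is the Euclidean norm. In particular, for all $\theta,\theta'\in\mathcal S_{m,\varepsilon}$ and $x\in\mathbb{R}$, $$|\log f_\theta(x)-\log f_{\theta'}(x)|\le C_{m,\varepsilon,k}(1+x^2)\,\|\theta-\theta'\|,$$ and the same bound holds with $\|\theta-\theta'\|$ replaced by the orbit distance $d_{\mathfrak S_k}(\thet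a,\theta')$.
   Context: For $\theta=(\pi,\mu,t)$ with $\pi\in\Delta_{k-1}=\{\pi\in[0,1]^k:\sum_j\pi_j=1\}$, $\mu\in\mathbb{R}^k$, $t\in\mathbb{R}^k$ and $\sigma_j=e^{t_j}$, the $k$-component Gaussian mixture density is $f_\theta(x)=\sum_{j=1}^k\pi_j\varphi(x;\mu_j,\sigma_j)$, where $\varphi(x;\mu,\sigma)=\frac{1}{\sqrt{2\pi}\,\sigma}\exp(-\frac{(x-\mu)^2}{2\sigma^2})$. Partial derivatives in $\pi_j$ are taken of the same formula treating $\pi_1,\dots,\pi_k$ as free coordinates. The sieve is $\mathcal S_{m,\varepsilon}=\{\pi\in\Delta_{k-1}:\min_j\pi_j\ge\varepsilon\}\times[-m,m]^k\times[-m,m]^k$, in coordinates $(\pi,\mu,t)$. The symmetric group $\mathfrak S_k$ acts by simultaneously permuting the coordinates of $\pi$, $\mu$ and $t$, and $d_{\mathfrak S_k}(\theta,\theta')=\min_{\tau\in\mathfrak S_k}\|\theta-\tau\cdot\theta'\|$. *)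

theory Defs
  imports "HOL-Probability.Probability"
begin

text \<open>
  A parameter is a triple \<open>(p, \<mu>, t)\<close> of vectors indexed by the type \<open>'k\<close>, so that
  \<open>k = CARD('k)\<close>. The product norm on this type is the Euclidean norm of the \<open>3k\<close>
  coordinates. Weights are written \<open>p\<close> because \<open>pi\<close> is the circle constant.
\<close>

type_synonym 'k params = "(real, 'k) vec \<times> (real, 'k) vec \<times> (real, 'k) vec"

text \<open>The library density has normalising factor \<open>1 / sqrt (2 * pi * \<sigma>\<^sup>2)\<close>.\<close>

lemma normal_density_eq:
  assumes "0 < \<sigma>"
  shows "normal_density \<mu> \<sigma> x = 1 / (sqrt (2 * pi) * \<sigma>) * exp (- ((x - \<mu>)\<^sup>2 / (2 * \<sigma>\<^sup>2)))"
  using assms by (simp add: normal_density_def real_sqrt_mult)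

text \<open>The mixture formula is defined on all of \<open>\<real>\<^sup>3\<^sup>k\<close>, not only for weights in the simplex, so that
  its derivatives in the weights treat these as free coordinates.\<close>

fun mixture_density :: "'k::finite params \<Rightarrow> real \<Rightarrow> real" where
  "mixture_density (p, \<mu>, t) x = (\<Sum>j\<in>UNIV. p $ j * normal_density (\<mu> $ j) (exp (t $ j)) x)"

fun responsibility :: "'k::finite \<Rightarrow> real \<Rightarrow> 'k params \<Rightarrow> real" where
  "responsibility j x (p, \<mu>, t) =
     p $ j * normal_density (\<mu> $ j) (exp (t $ j)) x / mixture_density (p, \<mu>, t) x"

definition prob_simplex :: "(real, 'k::finite) vec set" where
  "prob_simplex = {p. (\<forall>j. p $ j \<in> {0..1}) \<and> (\<Sum>j\<in>UNIV. p $ j) = 1}"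

definition sieve :: "real \<Rightarrow> real \<Rightarrow> 'k::finite params set" where
  "sieve m \<epsilon> = {p \<in> prob_simplex. Min (range (\<lambda>j. p $ j)) \<ge> \<epsilon>}
      \<times> {\<mu>. \<forall>j. \<mu> $ j \<in> {-m..m}} \<times> {t. \<forall>j. t $ j \<in> {-m..m}}"

definition set_coord :: "(real, 'k::finite) vec \<Rightarrow> 'k \<Rightarrow> real \<Rightarrow> (real, 'k) vec" where
  "set_coord v j s = (\<chi> i. if i = j then s else v $ i)"

text \<open>Meaningful only where \<open>F\<close> is differentiable; the derivative is the full one on the
  ambient space, not one within a constraint set.\<close>

definition gradient :: "('a::real_inner \<Rightarrow> real) \<Rightarrow> 'a \<Rightarrow> 'a" where
  "gradient F a = (THE D. GDERIV F a :> D)"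

definition permute_coords :: "('k \<Rightarrow> 'k) \<Rightarrow> (real, 'k::finite) vec \<Rightarrow> (real, 'k) vec" where
  "permute_coords \<tau> v = (\<chi> i. v $ (inv \<tau> i))"

fun permute_params :: "('k \<Rightarrow> 'k) \<Rightarrow> 'k::finite params \<Rightarrow> 'k params" where
  "permute_params \<tau> (p, \<mu>, t) = (permute_coords \<tau> p, permute_coords \<tau> \<mu>, permute_coords \<tau> t)"

definition orbit_dist :: "'k::finite params \<Rightarrow> 'k params \<Rightarrow> real" where
  "orbit_dist \<theta> \<theta>' = Min ((\<lambda>\<tau>. norm (\<theta> - permute_params \<tau> \<theta>')) ` {\<tau>. \<tau> permutes UNIV})"

end

theory Submission
  imports Defs
begin

text \<open>
  Differentiating \<open>\<eta> \<mapsto> ln (mixture_density \<eta> x)\<close> once on the ambient space yields the score vector;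
  the partial derivatives are its pairings with the coordinate axes. On the sieve the
  responsibilities are at most 1, the weights at least \<open>\<epsilon>\<close> and the scales at least \<open>exp (- m)\<close>, so
  each coordinate of the score grows at most quadratically in \<open>x\<close>. The sieve is convex, so the mean
  value inequality gives the Lipschitz bound, and since both the sieve and the mixture are
  permutation invariant, it passes to the orbit distance.
\<close>

section \<open>Gaussian densities in log-scale coordinates, and responsibilities\<close>

text \<open>Absorbing the factor \<open>1 / exp t\<close> into the exponent leaves a single
  exponential times a constant, so that one use of the chain rule for \<open>exp\<close>
  differentiates in mean and log-scale together.\<close>

lemma normal_density_exp_eq:
  "normal_density \<mu> (exp t) x =
     exp (- t - (x - \<mu>)\<^sup>2 * exp (- 2 * t) / 2) / sqrt (2 * pi)"
proof -
  have "exp (- 2 * t) = 1 / (exp t)\<^sup>2"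
    by (simp add: exp_minus exp_double inverse_eq_divide)
  then have "- t - (x - \<mu>)\<^sup>2 * exp (- 2 * t) / 2 = - t + - ((x - \<mu>)\<^sup>2 / (2 * (exp t)\<^sup>2))"
    by simp
  then have "exp (- t - (x - \<mu>)\<^sup>2 * exp (- 2 * t) / 2) =
      inverse (exp t) * exp (- ((x - \<mu>)\<^sup>2 / (2 * (exp t)\<^sup>2)))"
    by (simp only: exp_add exp_minus[of t])
  then show ?thesis
    by (simp only: normal_density_eq[OF exp_gt_zero] divide_inverse inverse_mult_distrib
        mult_1_left mult_ac)
qed

lemma mixture_density_eq:
  "mixture_density \<theta> x =
     (\<Sum>j\<in>UNIV. fst \<theta> $ j * normal_density (fst (snd \<theta>) $ j) (exp (snd (snd \<theta>) $ j)) x)"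
  by (cases \<theta>) simp

lemma mixture_density_pos:
  assumes "\<And>j. 0 < p $ j"
  shows "0 < mixture_density (p, \<mu>, t) x"
  by (auto intro!: sum_pos mult_pos_pos normal_density_pos assms)

lemma responsibility_nonneg:
  assumes "\<And>j. 0 < p $ j"
  shows "0 \<le> responsibility j x (p, \<mu>, t)"
  using mixture_density_pos[of p \<mu> t x, OF assms] assms[of j] by simp

lemma sum_responsibility:
  assumes "\<And>j. 0 < p $ j"
  shows "(\<Sum>j\<in>UNIV. responsibility j x (p, \<mu>, t)) = 1"
  using mixture_density_pos[of p \<mu> t x, OF assms]
  by (simp flip: sum_divide_distrib)

lemma responsibility_le_1:
  assumes "\<And>j. 0 < p $ j"
  shows "responsibility j x (p, \<mu>, t) \<le> 1"
proof -
  have "responsibility j x (p, \<mu>, t) \<le> (\<Sum>j\<in>UNIV. responsibility j x (p, \<mu>, t))"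
    by (intro member_le_sum responsibility_nonneg assms) auto
  then show ?thesis
    by (simp add: sum_responsibility assms del: responsibility.simps)
qed

section \<open>The score vector and the derivative of the log-density\<close>

text \<open>A closed form for the gradient of the log-density in the ambient coordinates; the proofs
  work with it, since \<open>gradient\<close> itself is only a definite description.\<close>

fun score :: "real \<Rightarrow> 'k::finite params \<Rightarrow> 'k params" where
  "score x (p, \<mu>, t) =
     ((\<chi> j. responsibility j x (p, \<mu>, t) / p $ j),
      (\<chi> j. responsibility j x (p, \<mu>, t) * ((x - \<mu> $ j) / (exp (t $ j))\<^sup>2)),
      (\<chi> j. responsibility j x (p, \<mu>, t) * (-1 + (x - \<mu> $ j)\<^sup>2 / (exp (t $ j))\<^sup>2)))"

text \<open>Differentiating an exponential reproduces it, so the density factors out of the whole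
  derivative; this factor later turns into the responsibility. The functions \<open>a\<close>,
  \<open>b\<close>, \<open>c\<close> stand for the coordinate projections of one mixture
  component.\<close>

lemma has_derivative_weighted_normal_density:
  fixes a b c :: "'a::real_normed_vector \<Rightarrow> real"
  assumes [derivative_intros]: "(a has_derivative a') (at z)"
    "(b has_derivative b') (at z)" "(c has_derivative c') (at z)"
  shows "((\<lambda>z. a z * normal_density (b z) (exp (c z)) x) has_derivative
     (\<lambda>h. normal_density (b z) (exp (c z)) x *
        (a' h + a z * (b' h * ((x - b z) / (exp (c z))\<^sup>2)
           + c' h * (-1 + (x - b z)\<^sup>2 / (exp (c z))\<^sup>2))))) (at z)"
proof -
  have e: "exp (- 2 * c z) = 1 / (exp (c z))\<^sup>2"
    by (simp add: exp_minus exp_double inverse_eq_divide)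
  have "((\<lambda>z. - c z - (x - b z)\<^sup>2 * exp (- 2 * c z) / 2) has_derivative
      (\<lambda>h. b' h * ((x - b z) * exp (- 2 * c z)) + c' h * (-1 + (x - b z)\<^sup>2 * exp (- 2 * c z)))) (at z)"
    by (rule derivative_eq_intros refl | simp)+ (simp add: fun_eq_iff field_simps)
  \<comment> \<open>The constant \<open>1 / sqrt (2 * pi)\<close> restores the normalising factor of
    the density.\<close>
  from has_derivative_mult_left[OF has_derivative_exp[OF this], of "1 / sqrt (2 * pi)"]
  have N: "((\<lambda>z. normal_density (b z) (exp (c z)) x) has_derivative
      (\<lambda>h. normal_density (b z) (exp (c z)) x *
        (b' h * ((x - b z) / (exp (c z))\<^sup>2) + c' h * (-1 + (x - b z)\<^sup>2 / (exp (c z))\<^sup>2)))) (at z)"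
    unfolding normal_density_exp_eq e by (simp only: divide_inverse mult_1_left mult_ac)
  show ?thesis
    by (rule has_derivative_eq_rhs[OF has_derivative_mult[OF assms(1) N]])
      (simp add: fun_eq_iff algebra_simps)
qed

text \<open>Positive weights make the mixture positive, so \<open>ln\<close> is differentiable there
  and the derivative is that of the mixture divided by the mixture. The quotient is then read off as
  a pairing with \<open>score\<close>.\<close>

lemma GDERIV_ln_mixture_density:
  fixes p :: "real ^ 'k"
  assumes "\<And>j. 0 < p $ j"
  shows "GDERIV (\<lambda>\<eta>. ln (mixture_density \<eta> x)) (p, \<mu>, t) :> score x (p, \<mu>, t)"
proof -
  let ?f = "mixture_density (p, \<mu>, t) x"
  let ?n = "\<lambda>j. normal_density (\<mu> $ j) (exp (t $ j)) x"
  let ?D = "\<lambda>h::'k params. \<Sum>j\<in>UNIV. ?n j * (fst h $ j + p $ j *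
       (fst (snd h) $ j * ((x - \<mu> $ j) / (exp (t $ j))\<^sup>2)
        + snd (snd h) $ j * (-1 + (x - \<mu> $ j)\<^sup>2 / (exp (t $ j))\<^sup>2)))"
  have f: "0 < ?f"
    by (intro mixture_density_pos assms)
  \<comment> \<open>Projections are bounded linear, hence their own derivatives.\<close>
  have lin: "bounded_linear (\<lambda>h::'k params. fst h $ j)"
    "bounded_linear (\<lambda>h::'k params. fst (snd h) $ j)"
    "bounded_linear (\<lambda>h::'k params. snd (snd h) $ j)" for j
    by (intro bounded_linear_compose[OF bounded_linear_vec_nth]
        bounded_linear_compose[OF bounded_linear_fst]
        bounded_linear_compose[OF bounded_linear_snd]
        bounded_linear_fst bounded_linear_snd)+
  have "((\<lambda>\<eta>. mixture_density \<eta> x) has_derivative ?D) (at (p, \<mu>, t))"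
    unfolding mixture_density_eq
    using has_derivative_weighted_normal_density[OF lin[THEN bounded_linear_imp_has_derivative],
        where z = "(p, \<mu>, t)" and x = x]
    by (intro has_derivative_sum) simp
  then have "((\<lambda>\<eta>. ln (mixture_density \<eta> x)) has_derivative (\<lambda>h. ?D h / ?f)) (at (p, \<mu>, t))"
    using f by (auto intro!: derivative_eq_intros simp: inverse_eq_divide simp del: mixture_density.simps)
  moreover have "?D h / ?f = inner h (score x (p, \<mu>, t))" for h
  proof (cases h)
    case (fields u v w)
    \<comment> \<open>In the \<mu> and t terms, \<open>p $ j * ?n j / ?f\<close> is the
      responsibility. The weight term carries no factor \<open>p $ j\<close>, which is why it
      becomes the responsibility divided by \<open>p $ j\<close>.\<close>
    have "?n j * (u $ j + p $ j * (v $ j * ((x - \<mu> $ j) / (exp (t $ j))\<^sup>2)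
        + w $ j * (-1 + (x - \<mu> $ j)\<^sup>2 / (exp (t $ j))\<^sup>2))) / ?f
      = u $ j * (responsibility j x (p, \<mu>, t) / p $ j)
        + (v $ j * (responsibility j x (p, \<mu>, t) * ((x - \<mu> $ j) / (exp (t $ j))\<^sup>2))
        + w $ j * (responsibility j x (p, \<mu>, t) * (-1 + (x - \<mu> $ j)\<^sup>2 / (exp (t $ j))\<^sup>2)))" for j
      using f assms[of j] unfolding responsibility.simps
      by (simp add: field_simps del: mixture_density.simps)
    then show ?thesis
      by (simp add: fields inner_vec_def sum_divide_distrib sum.distrib
          del: mixture_density.simps responsibility.simps)
  qed
  ultimately show ?thesis
    unfolding gderiv_def by simp
qed

section \<open>The gradient and the partial derivatives\<close>

text \<open>A Frechet derivative at a point is unique, and the inner product is nondegenerate, so at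
  most one vector represents it.\<close>

lemma gradient_eqI:
  assumes "GDERIV F a :> D"
  shows "gradient F a = D"
proof -
  have "E = D" if "GDERIV F a :> E" for E
  proof -
    have "(\<lambda>h. inner h E) = (\<lambda>h. inner h D)"
      using that assms unfolding gderiv_def by (rule has_derivative_unique)
    then show ?thesis
      by (metis vector_eq_rdot inner_commute)
  qed
  then show ?thesis
    unfolding gradient_def using assms by blast
qed

lemma set_coord_nth [simp]: "set_coord v j (v $ j) = v"
  by (simp add: set_coord_def vec_eq_iff)

lemma has_derivative_set_coord:
  "(set_coord v j has_derivative (\<lambda>h. axis j h)) (at s)"
proof -
  \<comment> \<open>Varying one coordinate traces an affine line: a fixed point plus a multiple of
    an axis.\<close>
  have eq: "set_coord v j = (\<lambda>s. axis j s + set_coord v j 0)"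
    by (auto simp: fun_eq_iff vec_eq_iff set_coord_def axis_def)
  have "bounded_linear (axis j :: real \<Rightarrow> real ^ 'a)"
    by (intro bounded_linearI'[where 'a=real]) (auto simp: vec_eq_iff axis_def)
  then have "(axis j has_derivative (axis j :: real \<Rightarrow> real ^ 'a)) (at s)"
    by (rule bounded_linear_imp_has_derivative)
  then show ?thesis
    by (subst eq) (rule has_derivative_add_const)
qed

text \<open>Each partial is the full derivative composed with a coordinate line; pairing the score
  with an axis selects one entry.\<close>

lemma ln_mixture_density_partials:
  assumes "\<And>j. 0 < p $ j"
  shows "((\<lambda>s. ln (mixture_density (set_coord p j s, \<mu>, t) x)) has_real_derivative
           responsibility j x (p, \<mu>, t) / p $ j) (at (p $ j))"
    and "((\<lambda>s. ln (mixture_density (p, set_coord \<mu> j s, t) x)) has_real_derivative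
           responsibility j x (p, \<mu>, t) * ((x - \<mu> $ j) / (exp (t $ j))\<^sup>2)) (at (\<mu> $ j))"
    and "((\<lambda>s. ln (mixture_density (p, \<mu>, set_coord t j s) x)) has_real_derivative
           responsibility j x (p, \<mu>, t) * (-1 + (x - \<mu> $ j)\<^sup>2 / (exp (t $ j))\<^sup>2)) (at (t $ j))"
proof -
  have D: "((\<lambda>\<eta>. ln (mixture_density \<eta> x)) has_derivative (\<lambda>h. inner h (score x (p, \<mu>, t))))
      (at (p, \<mu>, t))"
    using GDERIV_ln_mixture_density[OF assms] unfolding gderiv_def .
  note [simp del] = mixture_density.simps responsibility.simps
  \<comment> \<open>Here \<open>g\<close> is a curve through the parameter with velocity map
    \<open>g'\<close>, and \<open>d\<close> is the score paired with its velocity.\<close>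
  have chain: "((\<lambda>s. ln (mixture_density (g s) x)) has_real_derivative d) (at s)"
    if "(g has_derivative g') (at s)" "g s = (p, \<mu>, t)"
       "\<And>h. inner (g' h) (score x (p, \<mu>, t)) = h * d" for g g' s d
    unfolding has_field_derivative_def
    using has_derivative_compose[OF that(1) D[folded that(2)]]
    by (simp only: that(2,3) mult.commute[of _ d])
  show "((\<lambda>s. ln (mixture_density (set_coord p j s, \<mu>, t) x)) has_real_derivative
           responsibility j x (p, \<mu>, t) / p $ j) (at (p $ j))"
    by (rule chain, (rule has_derivative_Pair has_derivative_set_coord has_derivative_const)+)
      (simp_all add: inner_axis')
  show "((\<lambda>s. ln (mixture_density (p, set_coord \<mu> j s, t) x)) has_real_derivative
           responsibility j x (p, \<mu>, t) * ((x - \<mu> $ j) / (exp (t $ j))\<^sup>2)) (at (\<mu> $ j))"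
    by (rule chain, (rule has_derivative_Pair has_derivative_set_coord has_derivative_const)+)
      (simp_all add: inner_axis')
  show "((\<lambda>s. ln (mixture_density (p, \<mu>, set_coord t j s) x)) has_real_derivative
           responsibility j x (p, \<mu>, t) * (-1 + (x - \<mu> $ j)\<^sup>2 / (exp (t $ j))\<^sup>2)) (at (t $ j))"
    by (rule chain, (rule has_derivative_Pair has_derivative_set_coord has_derivative_const)+)
      (simp_all add: inner_axis')
qed

section \<open>Convexity of the sieve and quadratic growth of the score\<close>

lemma mem_sieve_iff:
  "(p, \<mu>, t) \<in> sieve m \<epsilon> \<longleftrightarrow>
     p \<in> prob_simplex \<and> (\<forall>j. \<epsilon> \<le> p $ j) \<and> (\<forall>j. \<mu> $ j \<in> {-m..m}) \<and> (\<forall>j. t $ j \<in> {-m..m})"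
  by (auto simp: sieve_def)

text \<open>The sieve is a product of boxes, the first of them cut by the hyperplane of weights with
  sum 1.\<close>

lemma convex_sieve: "convex (sieve m \<epsilon> :: 'k::finite params set)"
proof -
  have box: "convex {v :: real ^ 'k. \<forall>j. v $ j \<in> {a..b}}" for a b
    unfolding convex_def
    by (auto intro!: convexD[OF convex_real_interval(5), unfolded real_scaleR_def]
        simp del: atLeastAtMost_iff)
  have sum: "convex {v :: real ^ 'k. (\<Sum>j\<in>UNIV. v $ j) = 1}"
    by (auto simp: convex_def sum.distrib simp flip: sum_distrib_left)
  \<comment> \<open>The lower bound \<open>max 0 \<epsilon>\<close> merges the constraint from the
    simplex with that from the sieve.\<close>
  have "sieve m \<epsilon> = ({v :: real ^ 'k. \<forall>j. v $ j \<in> {max 0 \<epsilon>..1}} \<inter> {v. (\<Sum>j\<in>UNIV. v $ j) = 1})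
      \<times> {v. \<forall>j. v $ j \<in> {-m..m}} \<times> {v. \<forall>j. v $ j \<in> {-m..m}}"
    by (auto simp: sieve_def prob_simplex_def)
  then show ?thesis
    by (simp only: convex_Times convex_Int box sum)
qed

text \<open>Each block is bounded by its l1 norm, whence the factor \<open>CARD('k)\<close>. The
  weights contribute \<open>1 / \<epsilon>\<close>, the means \<open>(1 + m) * exp (2 * m)\<close>,
  and the log-scales \<open>1 + (2 + 2 * m\<^sup>2) * exp (2 * m)\<close>.\<close>

lemma norm_score_le:
  fixes \<theta> :: "'k::finite params"
  assumes "\<theta> \<in> sieve m \<epsilon>" "0 < \<epsilon>"
  shows "norm (score x \<theta>) \<le>
    real CARD('k) * (1 / \<epsilon> + 1 + (3 + m + 2 * m\<^sup>2) * exp (2 * m)) * (1 + x\<^sup>2)"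
proof (cases \<theta>)
  case (fields p \<mu> t)
  let ?r = "\<lambda>j. responsibility j x (p, \<mu>, t)"
  have sv: "\<epsilon> \<le> p $ j" "\<bar>\<mu> $ j\<bar> \<le> m" "\<bar>t $ j\<bar> \<le> m" for j
    using assms(1) unfolding fields mem_sieve_iff by (auto simp: abs_le_iff minus_le_iff)
  then have p: "0 < p $ j" for j
    using assms(2) less_le_trans by blast
  \<comment> \<open>A point of the sieve exists, which forces the box to be nonempty.\<close>
  have m: "0 \<le> m"
    using sv(2) abs_ge_zero order_trans by blast
  note [simp del] = mixture_density.simps responsibility.simps
  have r: "\<bar>?r j\<bar> \<le> 1" for j
    using responsibility_nonneg[OF p] responsibility_le_1[OF p] by simp
  have rb: "\<bar>?r j * y\<bar> \<le> \<bar>y\<bar>" for j y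
    using mult_right_mono[OF r[of j], of "\<bar>y\<bar>"] by (simp add: abs_mult)
  \<comment> \<open>The inverse variance is \<open>exp (- 2 * t $ j)\<close>, largest at the lower
    end \<open>-m\<close> of the log-scale range.\<close>
  have \<sigma>: "\<bar>y / (exp (t $ j))\<^sup>2\<bar> \<le> \<bar>y\<bar> * exp (2 * m)" for j y
  proof -
    have "\<bar>y / (exp (t $ j))\<^sup>2\<bar> = \<bar>y\<bar> * exp (- 2 * t $ j)"
      by (simp add: exp_minus exp_double divide_inverse abs_mult)
    also have "\<dots> \<le> \<bar>y\<bar> * exp (2 * m)"
      using sv(3)[of j] by (intro mult_left_mono) auto
    finally show ?thesis .
  qed
  have x1: "\<bar>x\<bar> \<le> 1 + x\<^sup>2"
    using zero_le_power2[of "\<bar>x\<bar> - 1/2"] by (simp add: power2_eq_square algebra_simps)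
  have y1: "\<bar>x - \<mu> $ j\<bar> \<le> (1 + m) * (1 + x\<^sup>2)" for j
  proof -
    have "\<bar>x - \<mu> $ j\<bar> \<le> 1 + x\<^sup>2 + m"
      using x1 sv(2)[of j] by linarith
    then show ?thesis
      using m by (simp add: algebra_simps) (smt (verit) mult_nonneg_nonneg zero_le_power2)
  qed
  have y2: "(x - \<mu> $ j)\<^sup>2 \<le> (2 + 2 * m\<^sup>2) * (1 + x\<^sup>2)" for j
  proof -
    \<comment> \<open>The right side minus the left side is the square of
      \<open>x + \<mu> $ j\<close>.\<close>
    have "(x - \<mu> $ j)\<^sup>2 \<le> 2 * x\<^sup>2 + 2 * (\<mu> $ j)\<^sup>2"
      using zero_le_power2[of "x + \<mu> $ j"] by (simp add: power2_eq_square algebra_simps)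
    moreover have "(\<mu> $ j)\<^sup>2 \<le> m\<^sup>2"
      using sv(2)[of j] m by (simp add: abs_le_square_iff[symmetric])
    moreover have "0 \<le> m\<^sup>2 * x\<^sup>2"
      by simp
    ultimately show ?thesis
      unfolding ring_distribs by linarith
  qed
  have "\<bar>?r j / p $ j\<bar> \<le> 1 / \<epsilon> * (1 + x\<^sup>2)" for j
  proof -
    have "\<bar>?r j / p $ j\<bar> \<le> 1 / p $ j"
      using rb[of j "1 / p $ j"] p[of j] by simp
    also have "\<dots> \<le> 1 / \<epsilon> * 1"
      using sv(1)[of j] assms(2) by (simp add: frac_le)
    also have "\<dots> \<le> 1 / \<epsilon> * (1 + x\<^sup>2)"
      using assms(2) by (intro mult_left_mono) auto
    finally show ?thesis .
  qed
  then have "norm (fst (score x \<theta>)) \<le> real CARD('k) * (1 / \<epsilon> * (1 + x\<^sup>2))"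
    unfolding fields by (intro order_trans[OF norm_le_l1_cart] sum_bounded_above) simp
  moreover have "\<bar>?r j * ((x - \<mu> $ j) / (exp (t $ j))\<^sup>2)\<bar> \<le> (1 + m) * (1 + x\<^sup>2) * exp (2 * m)" for j
    using order_trans[OF rb order_trans[OF \<sigma> mult_right_mono[OF y1]]] by simp
  then have "norm (fst (snd (score x \<theta>))) \<le> real CARD('k) * ((1 + m) * (1 + x\<^sup>2) * exp (2 * m))"
    unfolding fields by (intro order_trans[OF norm_le_l1_cart] sum_bounded_above) simp
  moreover have "\<bar>?r j * (-1 + (x - \<mu> $ j)\<^sup>2 / (exp (t $ j))\<^sup>2)\<bar>
      \<le> 1 + x\<^sup>2 + (2 + 2 * m\<^sup>2) * (1 + x\<^sup>2) * exp (2 * m)" for j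
  proof -
    have "\<bar>(x - \<mu> $ j)\<^sup>2 / (exp (t $ j))\<^sup>2\<bar> \<le> (2 + 2 * m\<^sup>2) * (1 + x\<^sup>2) * exp (2 * m)"
      using order_trans[OF \<sigma>[of "(x - \<mu> $ j)\<^sup>2" j]] mult_right_mono[OF y2[of j], of "exp (2 * m)"]
      by simp
    \<comment> \<open>The term -1 costs at most 1, which is enlarged to \<open>1 + x\<^sup>2\<close>
      so that all three blocks share this factor.\<close>
    moreover have "0 \<le> x\<^sup>2"
      by simp
    ultimately show ?thesis
      using rb[of j "-1 + (x - \<mu> $ j)\<^sup>2 / (exp (t $ j))\<^sup>2"] by linarith
  qed
  then have "norm (snd (snd (score x \<theta>))) \<le>
      real CARD('k) * (1 + x\<^sup>2 + (2 + 2 * m\<^sup>2) * (1 + x\<^sup>2) * exp (2 * m))"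
    unfolding fields by (intro order_trans[OF norm_le_l1_cart] sum_bounded_above) simp
  moreover have "norm (score x \<theta>) \<le>
      norm (fst (score x \<theta>)) + norm (fst (snd (score x \<theta>))) + norm (snd (snd (score x \<theta>)))"
    using norm_Pair_le[of "fst (score x \<theta>)" "snd (score x \<theta>)"]
      norm_Pair_le[of "fst (snd (score x \<theta>))" "snd (snd (score x \<theta>))"] by simp
  ultimately have "norm (score x \<theta>) \<le> real CARD('k) * (1 / \<epsilon> * (1 + x\<^sup>2))
      + real CARD('k) * ((1 + m) * (1 + x\<^sup>2) * exp (2 * m))
      + real CARD('k) * (1 + x\<^sup>2 + (2 + 2 * m\<^sup>2) * (1 + x\<^sup>2) * exp (2 * m))"
    by linarith
  also have "\<dots> = real CARD('k) * (1 / \<epsilon> + 1 + (3 + m + 2 * m\<^sup>2) * exp (2 * m)) * (1 + x\<^sup>2)"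
    by (simp add: algebra_simps)
  finally show ?thesis .
qed

section \<open>Permutation invariance and the orbit distance\<close>

text \<open>All three blocks are relabelled by the same bijection, so the sum over components is
  merely reindexed.\<close>

lemma mixture_density_permute:
  assumes "\<tau> permutes UNIV"
  shows "mixture_density (permute_params \<tau> \<theta>) x = mixture_density \<theta> x"
proof (cases \<theta>)
  case (fields p \<mu> t)
  have "bij (inv \<tau>)"
    by (intro permutes_imp_bij permutes_inv assms)
  then show ?thesis
    using sum.reindex_bij_betw[of "inv \<tau>" UNIV UNIV
        "\<lambda>j. p $ j * normal_density (\<mu> $ j) (exp (t $ j)) x"]
    by (simp add: fields permute_coords_def)
qed

text \<open>The box constraints are the same for every index; only the sum of the weights has to be
  reindexed.\<close>

lemma permute_params_in_sieve:
  assumes "\<tau> permutes UNIV" "\<theta> \<in> sieve m \<epsilon>"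
  shows "permute_params \<tau> \<theta> \<in> sieve m \<epsilon>"
proof (cases \<theta>)
  case (fields p \<mu> t)
  have "bij (inv \<tau>)"
    by (intro permutes_imp_bij permutes_inv assms)
  then have "(\<Sum>j\<in>UNIV. p $ inv \<tau> j) = (\<Sum>j\<in>UNIV. p $ j)"
    by (rule sum.reindex_bij_betw)
  then show ?thesis
    using assms(2) by (simp add: fields mem_sieve_iff prob_simplex_def permute_coords_def)
qed

lemma orbit_dist_attained:
  obtains \<tau> where "\<tau> permutes UNIV" "orbit_dist \<theta> \<theta>' = norm (\<theta> - permute_params \<tau> \<theta>')"
proof -
  have "orbit_dist \<theta> \<theta>' \<in> (\<lambda>\<tau>. norm (\<theta> - permute_params \<tau> \<theta>')) ` {\<tau>. \<tau> permutes UNIV}"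
    unfolding orbit_dist_def
    \<comment> \<open>There are finitely many permutations, and the identity is one.\<close>
    by (rule Min_in) (auto intro: finite_permutations permutes_id)
  then show ?thesis
    using that by auto
qed

theorem lemma4p2:
  fixes m \<epsilon> :: real
  assumes "CARD('k::finite) \<ge> 2" and "m \<ge> 1" and "0 < \<epsilon>" and "\<epsilon> \<le> 1 / real CARD('k)"
  shows
    "(\<forall>\<theta> \<in> (sieve m \<epsilon> :: 'k params set). \<forall>x.
        (\<forall>j. responsibility j x \<theta> \<in> {0..1}) \<and> (\<Sum>j\<in>UNIV. responsibility j x \<theta>) = 1)
   \<and> (\<forall>(p :: real ^ 'k) \<mu> t. (p, \<mu>, t) \<in> sieve m \<epsilon> \<longrightarrow> (\<forall>j x.
        ((\<lambda>s. ln (mixture_density (p, set_coord \<mu> j s, t) x)) has_real_derivative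
           responsibility j x (p, \<mu>, t) * ((x - \<mu> $ j) / (exp (t $ j))\<^sup>2)) (at (\<mu> $ j))
      \<and> ((\<lambda>s. ln (mixture_density (p, \<mu>, set_coord t j s) x)) has_real_derivative
           responsibility j x (p, \<mu>, t) * (-1 + (x - \<mu> $ j)\<^sup>2 / (exp (t $ j))\<^sup>2)) (at (t $ j))
      \<and> ((\<lambda>s. ln (mixture_density (set_coord p j s, \<mu>, t) x)) has_real_derivative
           responsibility j x (p, \<mu>, t) / p $ j) (at (p $ j))))
   \<and> (\<forall>\<theta> \<in> (sieve m \<epsilon> :: 'k params set). \<forall>x.
        GDERIV (\<lambda>\<eta>. ln (mixture_density \<eta> x)) \<theta> :> gradient (\<lambda>\<eta>. ln (mixture_density \<eta> x)) \<theta>)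
   \<and> (\<exists>C::real.
        (\<forall>x. (SUP \<theta> \<in> (sieve m \<epsilon> :: 'k params set).
                 ereal (norm (gradient (\<lambda>\<eta>. ln (mixture_density \<eta> x)) \<theta>))) \<le> ereal (C * (1 + x\<^sup>2)))
      \<and> (\<forall>\<theta> \<in> (sieve m \<epsilon> :: 'k params set). \<forall>\<theta>' \<in> sieve m \<epsilon>. \<forall>x.
            \<bar>ln (mixture_density \<theta> x) - ln (mixture_density \<theta>' x)\<bar> \<le> C * (1 + x\<^sup>2) * norm (\<theta> - \<theta>')
          \<and> \<bar>ln (mixture_density \<theta> x) - ln (mixture_density \<theta>' x)\<bar> \<le> C * (1 + x\<^sup>2) * orbit_dist \<theta> \<theta>'))"
proof -
  let ?S = "sieve m \<epsilon> :: 'k params set"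
  let ?F = "\<lambda>x (\<eta> :: 'k params). ln (mixture_density \<eta> x)"
  define C where "C = real CARD('k) * (1 / \<epsilon> + 1 + (3 + m + 2 * m\<^sup>2) * exp (2 * m))"
  have pos: "0 < p $ j" if "(p, \<mu>, t) \<in> ?S" for p \<mu> t j
    using that \<open>0 < \<epsilon>\<close> unfolding mem_sieve_iff by (meson less_le_trans)
  have G: "GDERIV (?F x) \<theta> :> score x \<theta>" if "\<theta> \<in> ?S" for \<theta> x
    using that GDERIV_ln_mixture_density pos by (cases \<theta>) blast
  have grad: "gradient (?F x) \<theta> = score x \<theta>" if "\<theta> \<in> ?S" for \<theta> x
    using G[OF that] by (rule gradient_eqI)
  have bound: "norm (score x \<theta>) \<le> C * (1 + x\<^sup>2)" if "\<theta> \<in> ?S" for \<theta> x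
    using norm_score_le[OF that \<open>0 < \<epsilon>\<close>] unfolding C_def .
  have lipschitz: "\<bar>?F x \<theta> - ?F x \<theta>'\<bar> \<le> C * (1 + x\<^sup>2) * norm (\<theta> - \<theta>')"
    if "\<theta> \<in> ?S" "\<theta>' \<in> ?S" for \<theta> \<theta>' x
  proof -
    have "norm (?F x \<theta> - ?F x \<theta>') \<le> C * (1 + x\<^sup>2) * norm (\<theta> - \<theta>')"
    \<comment> \<open>Mean value inequality on the convex sieve: by Cauchy-Schwarz, the operator
      norm of the derivative is at most the norm of the score.\<close>
    proof (rule differentiable_bound[OF convex_sieve _ _ that])
      fix \<eta> assume \<eta>: "\<eta> \<in> ?S"
      show "(?F x has_derivative (\<lambda>h. inner h (score x \<eta>))) (at \<eta> within ?S)"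
        using G[OF \<eta>] unfolding gderiv_def by (rule has_derivative_at_withinI)
      show "onorm (\<lambda>h. inner h (score x \<eta>)) \<le> C * (1 + x\<^sup>2)"
      proof (rule onorm_le)
        fix h
        have "norm (inner h (score x \<eta>)) \<le> norm (score x \<eta>) * norm h"
          using Cauchy_Schwarz_ineq2[of h "score x \<eta>"] by (simp add: mult.commute)
        also have "\<dots> \<le> C * (1 + x\<^sup>2) * norm h"
          by (intro mult_right_mono bound \<eta>) simp
        finally show "norm (inner h (score x \<eta>)) \<le> C * (1 + x\<^sup>2) * norm h" .
      qed
    qed
    then show ?thesis
      by simp
  qed
  have orbit: "\<bar>?F x \<theta> - ?F x \<theta>'\<bar> \<le> C * (1 + x\<^sup>2) * orbit_dist \<theta> \<theta>'"
    if "\<theta> \<in> ?S" "\<theta>' \<in> ?S" for \<theta> \<theta>' x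
  proof -
    \<comment> \<open>Replacing \<theta>' by its closest relabelling changes neither its log-density
      nor its membership in the sieve, so the Euclidean bound applies to the new pair.\<close>
    obtain \<tau> where \<tau>: "\<tau> permutes UNIV" "orbit_dist \<theta> \<theta>' = norm (\<theta> - permute_params \<tau> \<theta>')"
      by (rule orbit_dist_attained)
    show ?thesis
      using lipschitz[OF that(1) permute_params_in_sieve[OF \<tau>(1) that(2)], of x]
      by (simp add: mixture_density_permute[OF \<tau>(1)] \<tau>(2))
  qed
  show ?thesis
  proof (intro conjI)
    show "\<forall>\<theta>\<in>?S. \<forall>x. (\<forall>j. responsibility j x \<theta> \<in> {0..1}) \<and> (\<Sum>j\<in>UNIV. responsibility j x \<theta>) = 1"
      using pos
      by (auto intro!: responsibility_nonneg responsibility_le_1 sum_responsibility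
          simp del: responsibility.simps)
    show "\<forall>\<theta>\<in>?S. \<forall>x. GDERIV (?F x) \<theta> :> gradient (?F x) \<theta>"
      using G grad by simp
    show "\<forall>(p :: real ^ 'k) \<mu> t. (p, \<mu>, t) \<in> sieve m \<epsilon> \<longrightarrow> (\<forall>j x.
        ((\<lambda>s. ln (mixture_density (p, set_coord \<mu> j s, t) x)) has_real_derivative
           responsibility j x (p, \<mu>, t) * ((x - \<mu> $ j) / (exp (t $ j))\<^sup>2)) (at (\<mu> $ j))
      \<and> ((\<lambda>s. ln (mixture_density (p, \<mu>, set_coord t j s) x)) has_real_derivative
           responsibility j x (p, \<mu>, t) * (-1 + (x - \<mu> $ j)\<^sup>2 / (exp (t $ j))\<^sup>2)) (at (t $ j))
      \<and> ((\<lambda>s. ln (mixture_density (set_coord p j s, \<mu>, t) x)) has_real_derivative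
           responsibility j x (p, \<mu>, t) / p $ j) (at (p $ j)))"
      by (intro allI impI conjI ln_mixture_density_partials) (rule pos, assumption)+
    show "\<exists>C::real.
        (\<forall>x. (SUP \<theta> \<in> ?S. ereal (norm (gradient (?F x) \<theta>))) \<le> ereal (C * (1 + x\<^sup>2)))
      \<and> (\<forall>\<theta>\<in>?S. \<forall>\<theta>'\<in>?S. \<forall>x. \<bar>?F x \<theta> - ?F x \<theta>'\<bar> \<le> C * (1 + x\<^sup>2) * norm (\<theta> - \<theta>')
          \<and> \<bar>?F x \<theta> - ?F x \<theta>'\<bar> \<le> C * (1 + x\<^sup>2) * orbit_dist \<theta> \<theta>')"
      \<comment> \<open>Taken in \<open>ereal\<close>, the supremum needs only the pointwise
        bounds.\<close>
      by (intro exI[of _ C] conjI ballI allI SUP_least lipschitz orbit)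
        (simp_all add: grad bound)
  qed
qed

end
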